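(* Let $p$ be a prime and let $f:\mathbb{F}_p\to[0,1]$ be a function that is not identically $0$. Put $\theta := p^{-1}\sum_{n\in\mathbb{F}_p} f(n)$ and, for $a\in\mathbb{F}_p$, $\hat f(a):=\sum_{n\in\mathbb{F}_p} f(n)e^{2\pi i an/p}$. Let $a_1,\dots,a_p$ be any ordering of the elements of $\mathbb{F}_p$ such that $|\hat f(a_1)|\ge|\hat f(a_2)|\ge\cdots\ge|\hat f(a_p)|$, and set $\lambda_i:=\hat f(a_i)$ for $i=1,\dots,p$. Suppose that for some integer $k$ with $$1\le k<\frac{\log p}{\log 4}$$ and some $\gamma\ge 0$ we have $|\lambda_{k+1}|\le\gamma|\lambda_k|$. Then $$\bigl|\{n\in\mathbb{F}_p : (f*f)(n)>0\}\bigr|\ \ge\ p\bigl(1-2\theta p^2\gamma^2|\lambda_k|^{-2}\bigr).$$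
   Context: Convolution on $\mathbb{F}_p$ is $(f*g)(n)=\sum_{m\in\mathbb{F}_p} f(m)g(n-m)$. Elements of $\mathbb{F}_p$ are identified with residues $0,\dots,p-1$ in the exponentials. Note $|\lambda_1|=|\hat f(0)|$. *)

theory Defs
  imports "HOL-Analysis.Analysis" "HOL-Number_Theory.Residues"
begin

text \<open>
  The field with \<open>p\<close> elements is \<open>residue_ring (int p)\<close>, whose carrier is the set of integers
  \<open>{0..int p - 1}\<close>. A function on it is a function on \<open>int\<close> of which only the values on the
  carrier matter.
\<close>

abbreviation Fp :: "nat \<Rightarrow> int ring" where
  "Fp p \<equiv> residue_ring (int p)"

definition conv :: "nat \<Rightarrow> (int \<Rightarrow> real) \<Rightarrow> (int \<Rightarrow> real) \<Rightarrow> int \<Rightarrow> real" where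
  "conv p f g n = (\<Sum>m\<in>carrier (Fp p). f m * g (n \<ominus>\<^bsub>Fp p\<^esub> m))"

text \<open>The sign in the exponent is positive and there is no normalising factor.\<close>

definition fourier :: "nat \<Rightarrow> (int \<Rightarrow> real) \<Rightarrow> int \<Rightarrow> complex" where
  "fourier p f a =
     (\<Sum>n\<in>carrier (Fp p).
        complex_of_real (f n) * exp (2 * complex_of_real pi * \<i> * of_int a * of_int n / of_nat p))"

end

theory Submission
  imports Defs
begin

text \<open>
  Let \<open>A\<close> consist of the \<open>k\<close> largest frequencies. As \<open>4\<^sup>k < p\<close>, some dilate of \<open>A\<close> lies in an arc
  of length less than \<open>p/2\<close>, so the difference \<open>s\<close> of its extreme elements is represented only once
  as a difference in \<open>A\<close>, say by \<open>a\<^sub>0 + s\<close> and \<open>a\<^sub>0\<close>. If \<open>(f * f)(n) = 0\<close>, then \<open>f(m) f(n - m) = 0\<close>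
  for all \<open>m\<close>; hence the twisted convolution \<open>\<Sum>\<^sub>m f(m) e(sm/p) f(n - m)\<close> vanishes too, which is
  to say that the Fourier series with coefficients \<open>F(a + s) F(a)\<close>, \<open>F\<close> the Fourier transform
  of \<open>f\<close>, vanishes at \<open>n\<close>. Its term at
  \<open>a\<^sub>0\<close> has modulus at least \<open>|\<lambda>\<^sub>k|\<^sup>2\<close> for all \<open>n\<close>, whereas every other term has a factor of modulus at
  most \<open>|\<lambda>\<^sub>k\<^sub>+\<^sub>1|\<close>; so by Parseval the remaining terms can cancel it for few \<open>n\<close> only.
\<close>

section \<open>Additive characters modulo \<open>p\<close> and their orthogonality\<close>

definition echar :: "nat \<Rightarrow> int \<Rightarrow> complex" where
  "echar p x = cis (2 * pi * of_int x / of_nat p)"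

lemma echar_add: "echar p (x + y) = echar p x * echar p y"
  by (simp add: echar_def cis_mult ring_distribs add_divide_distrib)

lemma cnj_echar: "cnj (echar p x) = echar p (- x)"
  by (simp add: echar_def cis_cnj)

lemma norm_echar [simp]: "cmod (echar p x) = 1"
  by (simp add: echar_def)

lemma echar_power: "echar p x ^ n = echar p (x * int n)"
  by (simp add: echar_def Complex.DeMoivre mult_ac)

lemma echar_eq_1_iff:
  assumes "p > 0"
  shows "echar p x = 1 \<longleftrightarrow> int p dvd x"
proof -
  have "echar p x = 1 \<longleftrightarrow> (\<exists>n::int. 2 * pi * of_int x / of_nat p = of_int (2 * n) * pi)"
    by (simp add: echar_def cis_conv_exp exp_eq_1)
  also have "\<dots> \<longleftrightarrow> (\<exists>n::int. real_of_int x = real_of_int (int p * n))"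
    using assms by (simp add: field_simps)
  also have "\<dots> \<longleftrightarrow> int p dvd x"
    unfolding of_int_eq_iff dvd_def by auto
  finally show ?thesis .
qed

lemma echar_cong:
  assumes "p > 0" "int p dvd x - y"
  shows "echar p x = echar p y"
  using echar_add[of p "x - y" y] echar_eq_1_iff[of p "x - y"] assms by simp

lemma carrier_Fp: "carrier (Fp p) = {0..<int p}"
  by (auto simp: residue_ring_def)

lemma sum_echar:
  assumes "p > 0"
  shows "(\<Sum>n\<in>{0..<int p}. echar p (x * n)) = (if int p dvd x then of_nat p else 0)"
proof -
  have "(\<Sum>n\<in>{0..<int p}. echar p (x * n)) = (\<Sum>n\<in>int ` {0..<p}. echar p (x * n))"
    by (simp add: image_int_atLeastLessThan)
  also have "\<dots> = (\<Sum>n<p. echar p x ^ n)"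
    by (simp add: sum.reindex echar_power lessThan_atLeast0)
  also have "\<dots> = (if int p dvd x then of_nat p else 0)"
  proof (cases "int p dvd x")
    case True
    then have "echar p x = 1" using assms by (simp add: echar_eq_1_iff)
    with True show ?thesis by simp
  next
    case False
    then have "echar p x \<noteq> 1" using assms by (simp add: echar_eq_1_iff)
    moreover have "echar p x ^ p = 1" using assms by (simp add: echar_power echar_eq_1_iff)
    ultimately show ?thesis using False by (simp add: geometric_sum)
  qed
  finally show ?thesis .
qed

text \<open>Expanding the square gives a double sum over \<open>B\<close>, of which orthogonality
  keeps the diagonal, distinct elements of \<open>B\<close> being incongruent modulo
  \<open>p\<close>. A general \<open>B\<close> allows one frequency to be left out later.\<close>

lemma parseval:
  assumes "p > 0" "B \<subseteq> {0..<int p}"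
  shows "(\<Sum>n\<in>{0..<int p}. (cmod (\<Sum>b\<in>B. G b * echar p (b * n)))\<^sup>2)
    = real p * (\<Sum>b\<in>B. (cmod (G b))\<^sup>2)"
proof -
  let ?C = "{0..<int p}"
  have fin: "finite B" using assms(2) finite_subset by blast
  have diff: "int p dvd b - c \<longleftrightarrow> b = c" if "b \<in> B" "c \<in> B" for b c
  proof -
    have "b mod int p = b" "c mod int p = c" using that assms by auto
    then show ?thesis by (metis mod_eq_dvd_iff)
  qed
  have "complex_of_real (\<Sum>n\<in>?C. (cmod (\<Sum>b\<in>B. G b * echar p (b * n)))\<^sup>2)
    = (\<Sum>n\<in>?C. (\<Sum>b\<in>B. G b * echar p (b * n)) * (\<Sum>c\<in>B. cnj (G c) * echar p (- (c * n))))"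
    by (simp only: of_real_sum complex_norm_square cnj_sum complex_cnj_mult cnj_echar)
  also have "\<dots> = (\<Sum>n\<in>?C. \<Sum>b\<in>B. \<Sum>c\<in>B. G b * cnj (G c) * echar p ((b - c) * n))"
    unfolding sum_product by (intro sum.cong refl) (simp add: left_diff_distrib flip: echar_add)
  also have "\<dots> = (\<Sum>b\<in>B. \<Sum>c\<in>B. G b * cnj (G c) * (\<Sum>n\<in>?C. echar p ((b - c) * n)))"
    by (subst sum.swap, rule sum.cong[OF refl], subst sum.swap) (simp add: sum_distrib_left)
  also have "\<dots> = (\<Sum>b\<in>B. \<Sum>c\<in>B. if b = c then G b * cnj (G b) * of_nat p else 0)"
    using assms(1) by (intro sum.cong refl) (simp add: sum_echar diff)
  also have "\<dots> = (\<Sum>b\<in>B. G b * cnj (G b) * of_nat p)"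
    using fin by (simp add: sum.delta)
  also have "\<dots> = complex_of_real (real p * (\<Sum>b\<in>B. (cmod (G b))\<^sup>2))"
    by (simp only: of_real_sum of_real_mult complex_norm_square sum_distrib_left of_real_of_nat_eq
        mult_ac)
  finally show ?thesis by (simp only: of_real_eq_iff)
qed

section \<open>The Fourier transform and its shifts\<close>

lemma fourier_echar: "fourier p f a = (\<Sum>n\<in>{0..<int p}. of_real (f n) * echar p (n * a))"
  unfolding fourier_def carrier_Fp echar_def cis_conv_exp
  by (intro sum.cong refl arg_cong2[where f = "(*)"] arg_cong[where f = exp]) (simp add: mult_ac)

lemma fourier_mod:
  assumes "p > 0"
  shows "fourier p f (a mod int p) = fourier p f a"
  unfolding fourier_echar
  by (intro sum.cong refl arg_cong2[where f = "(*)"] echar_cong assms)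
    (metis mod_eq_dvd_iff mod_mult_right_eq)

lemma bij_betw_add_mod:
  assumes "p > 0"
  shows "bij_betw (\<lambda>a. (a + s) mod int p) {0..<int p} {0..<int p}"
proof (rule bij_betw_byWitness[where f' = "\<lambda>a. (a - s) mod int p"])
qed (use assms in \<open>auto simp: mod_simps\<close>)

text \<open>This is \<open>parseval\<close> with the roles exchanged: the values of \<open>f\<close>
  are the coefficients and \<open>a\<close> is the point. Hence the order \<open>n * a\<close> in
  \<open>fourier_echar\<close>.\<close>

lemma sum_fourier_square:
  assumes "p > 0"
  shows "(\<Sum>a\<in>{0..<int p}. (cmod (fourier p f a))\<^sup>2) = real p * (\<Sum>n\<in>{0..<int p}. (f n)\<^sup>2)"
  using parseval[OF assms subset_refl, of "\<lambda>n. of_real (f n)"]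
  by (simp add: fourier_echar)

lemma sum_fourier_shift_square:
  assumes "p > 0"
  shows "(\<Sum>a\<in>{0..<int p}. (cmod (fourier p f (a + s)))\<^sup>2) = real p * (\<Sum>n\<in>{0..<int p}. (f n)\<^sup>2)"
  using sum.reindex_bij_betw[OF bij_betw_add_mod[OF assms],
      of "\<lambda>a. (cmod (fourier p f a))\<^sup>2" s]
  by (simp add: fourier_mod assms sum_fourier_square)

section \<open>Dilation into a short arc, and a difference represented only once\<close>

lemma dilate_into_short_arc:
  assumes "finite A" "4 ^ card A < p"
  obtains t where "t \<in> {1..<int p}" "\<And>a. a \<in> A \<Longrightarrow> \<exists>b. [t * a = b] (mod int p) \<and> 4 * \<bar>b\<bar> < int p"
proof -
  \<comment> \<open>Dirichlet's pigeonhole argument: \<open>box t\<close> records, for each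
    \<open>a\<close> in \<open>A\<close>, the quarter of the residues in which \<open>t * a\<close>
    lies. There are at most \<open>4 ^ card A\<close> patterns, so two multipliers
    \<open>u < v\<close> share one, and \<open>v - u\<close> sends all of \<open>A\<close> close to
    0.\<close>
  define box where "box t = (\<lambda>a\<in>A. 4 * (t * a mod int p) div int p)" for t
  have p: "p > 0" using assms(2) by simp
  have "box ` {0..<int p} \<subseteq> A \<rightarrow>\<^sub>E {0..<4}"
  proof (clarsimp simp: box_def)
    fix t a
    have "0 \<le> t * a mod int p" "t * a mod int p < int p" using p by auto
    moreover from this have "4 * (t * a mod int p) div int p \<le> (4 * int p - 1) div int p"
      by (intro zdiv_mono1) auto
    moreover have "(4 * int p - 1) div int p = 3"
      by (rule int_div_pos_eq[of _ _ _ "int p - 1"]) (use p in auto)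
    ultimately show "0 \<le> 4 * (t * a mod int p) div int p \<and> 4 * (t * a mod int p) div int p < 4"
      using p by (simp add: pos_imp_zdiv_nonneg_iff)
  qed
  then have "card (box ` {0..<int p}) \<le> card (A \<rightarrow>\<^sub>E {0..<4::int})"
    using assms(1) by (intro card_mono finite_PiE) auto
  also have "\<dots> < card {0..<int p}"
    using assms by (simp add: card_funcsetE)
  finally have "\<not> inj_on box {0..<int p}"
    by (rule pigeonhole)
  then obtain u v where uv: "u \<in> {0..<int p}" "v \<in> {0..<int p}" "u < v" "box u = box v"
    unfolding inj_on_def by (metis linorder_neqE)
  show thesis
  proof
    show "v - u \<in> {1..<int p}" using uv by auto
    fix a assume "a \<in> A"
    define x y where "x = u * a mod int p" and "y = v * a mod int p"
    have "4 * x div int p = 4 * y div int p"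
      using uv(4) \<open>a \<in> A\<close> by (auto simp: box_def x_def y_def dest: fun_cong[of _ _ a])
    \<comment> \<open>The equal quotients cancel, which leaves a difference of two remainders in
      \<open>{0..<p}\<close>.\<close>
    then have "4 * (y - x) = 4 * y mod int p - 4 * x mod int p"
      by (simp add: minus_div_mult_eq_mod[symmetric])
    moreover have "0 \<le> 4 * x mod int p" "4 * x mod int p < int p"
      "0 \<le> 4 * y mod int p" "4 * y mod int p < int p"
      using p by auto
    ultimately have "4 * \<bar>y - x\<bar> < int p" by linarith
    moreover have "[(v - u) * a = y - x] (mod int p)"
      by (simp add: x_def y_def cong_def mod_simps left_diff_distrib)
    ultimately show "\<exists>b. [(v - u) * a = b] (mod int p) \<and> 4 * \<bar>b\<bar> < int p" by blast
  qed
qed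

text \<open>After dilation the representatives \<open>b a\<close> span less than \<open>p/2\<close>,
  so congruent differences of them are equal as integers. Only the pair of extremes attains the
  largest difference; \<open>s\<close> is that difference before dilation.\<close>

lemma unique_difference:
  assumes "prime p" "A \<subseteq> {0..<int p}" "A \<noteq> {}" "4 ^ card A < p"
  obtains s c where "c \<in> A" "(c + s) mod int p \<in> A"
    "\<And>a. a \<in> A \<Longrightarrow> (a + s) mod int p \<in> A \<Longrightarrow> a = c"
proof -
  have fin: "finite A" using assms(2) finite_subset by blast
  obtain t where t: "t \<in> {1..<int p}"
    and "\<And>a. a \<in> A \<Longrightarrow> \<exists>b. [t * a = b] (mod int p) \<and> 4 * \<bar>b\<bar> < int p"
    using dilate_into_short_arc[OF fin assms(4)] by blast
  then obtain b where b: "\<And>a. a \<in> A \<Longrightarrow> [t * a = b a] (mod int p)"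
      "\<And>a. a \<in> A \<Longrightarrow> 4 * \<bar>b a\<bar> < int p"
    by metis
  have cop: "coprime t (int p)"
    using t assms(1) prime_imp_coprime[of "int p" t] zdvd_not_zless[of t "int p"]
    by (auto simp: coprime_commute)
  have inj: "a = a'" if "a \<in> A" "a' \<in> A" "b a = b a'" for a a'
  proof -
    have "[t * a = t * a'] (mod int p)"
      using b(1)[OF that(1)] b(1)[OF that(2)] that(3) by (metis cong_sym cong_trans)
    then have "[a = a'] (mod int p)" using cop by (simp add: cong_mult_lcancel)
    moreover have "a \<in> {0..<int p}" "a' \<in> {0..<int p}" using that assms(2) by auto
    ultimately show ?thesis by (simp add: cong_def)
  qed
  have "Min (b ` A) \<in> b ` A" using fin assms(3) by simp
  then obtain c where c: "c \<in> A" "b c = Min (b ` A)" by (metis imageE)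
  have "Max (b ` A) \<in> b ` A" using fin assms(3) by simp
  then obtain d where d: "d \<in> A" "b d = Max (b ` A)" by (metis imageE)
  have c_le: "b c \<le> b a" and le_d: "b a \<le> b d" if "a \<in> A" for a
    using that fin c d by auto
  show thesis
  proof
    show "c \<in> A" by fact
    show "(c + (d - c)) mod int p \<in> A" using d assms(2) by auto
    fix a assume a: "a \<in> A" and "(a + (d - c)) mod int p \<in> A"
    then obtain a' where a': "a' \<in> A" "a' = (a + (d - c)) mod int p" by blast
    have "[a' = a + (d - c)] (mod int p)" using a' by (simp add: cong_def)
    then have "[t * a' = t * a + t * d - t * c] (mod int p)"
      using cong_scalar_left[of a' "a + (d - c)" "int p" t] by (simp add: algebra_simps)
    moreover have "[t * a + t * d - t * c = b a + b d - b c] (mod int p)"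
      using b(1) a c(1) d(1) by (intro cong_add cong_diff) auto
    ultimately have "[b a' = b a + b d - b c] (mod int p)"
      using b(1)[OF a'(1)] by (metis cong_sym cong_trans)
    then have "int p dvd b a' - (b a + b d - b c)" by (simp add: cong_iff_dvd_diff)
    \<comment> \<open>Four representatives, each of modulus below \<open>p/4\<close>: this is why
      arcs of this length were chosen.\<close>
    moreover have "\<bar>b a' - (b a + b d - b c)\<bar> < int p"
      using b(2)[OF a] b(2)[OF a'(1)] b(2)[OF c(1)] b(2)[OF d(1)] by linarith
    ultimately have "b a' - (b a + b d - b c) = 0"
      using dvd_imp_le_int[of "b a' - (b a + b d - b c)" "int p"] by (cases "b a' - (b a + b d - b c) = 0") auto
    then have "b a = b c" using c_le[OF a] le_d[OF a'(1)] by linarith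
    then show "a = c" using inj a c(1) by blast
  qed
qed

section \<open>Zeros of the convolution and a bound for their number\<close>

lemma minus_Fp:
  assumes "1 < p"
  shows "x \<ominus>\<^bsub>Fp p\<^esub> y = (x - y) mod int p"
proof -
  interpret residues "int p" "Fp p" by unfold_locales (use assms in auto)
  show ?thesis by (simp add: a_minus_def res_add_eq res_neg_eq mod_simps)
qed

lemma conv_nonpos_imp_product_zero:
  assumes "1 < p" "f \<in> {0..<int p} \<rightarrow> {0..}" "conv p f f n \<le> 0"
    and "m \<in> {0..<int p}" "l \<in> {0..<int p}" "int p dvd m + l - n"
  shows "f m * f l = 0"
proof -
  define h where "h i = f i * f ((n - i) mod int p)" for i
  have nonneg: "0 \<le> h i" if "i \<in> {0..<int p}" for i
  proof -
    have "(n - i) mod int p \<in> {0..<int p}" using assms(1) by simp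
    then show ?thesis using that assms(2) unfolding h_def Pi_iff by (simp del: atLeastLessThan_iff)
  qed
  have "conv p f f n = (\<Sum>i\<in>{0..<int p}. h i)"
    by (simp add: conv_def carrier_Fp minus_Fp[OF assms(1)] h_def)
  then have "(\<Sum>i\<in>{0..<int p}. h i) = 0"
    using assms(3) sum_nonneg[of "{0..<int p}" h] nonneg by fastforce
  then have "h m = 0"
    using sum_nonneg_0[of "{0..<int p}" h m] nonneg assms(4) by blast
  moreover have "l mod int p = (n - m) mod int p"
    using assms(6) by (simp add: mod_eq_dvd_iff algebra_simps)
  ultimately show ?thesis using assms(5) by (simp add: h_def)
qed

text \<open>Summing over \<open>a\<close> first leaves \<open>p\<close> times the products
  \<open>f m * f l\<close> with \<open>m + l\<close> congruent to \<open>n\<close>, twisted by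
  \<open>echar p (m * s)\<close>. The twist cannot revive a product that is zero.\<close>

lemma sum_fourier_shift_product:
  assumes "p > 0"
    and "\<And>m l. m \<in> {0..<int p} \<Longrightarrow> l \<in> {0..<int p} \<Longrightarrow> int p dvd m + l - n \<Longrightarrow> f m * f l = 0"
  shows "(\<Sum>a\<in>{0..<int p}. fourier p f (a + s) * fourier p f a * echar p (a * (- n))) = 0"
proof -
  let ?C = "{0..<int p}"
  have "(\<Sum>a\<in>?C. fourier p f (a + s) * fourier p f a * echar p (a * (- n)))
    = (\<Sum>a\<in>?C. \<Sum>m\<in>?C. \<Sum>l\<in>?C. of_real (f m * f l) * echar p (m * s) * echar p ((m + l - n) * a))"
    unfolding fourier_echar sum_product unfolding sum_distrib_right
    by (intro sum.cong refl)
      (simp add: algebra_simps flip: echar_add)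
  also have "\<dots> = (\<Sum>m\<in>?C. \<Sum>l\<in>?C. of_real (f m * f l) * echar p (m * s) *
      (\<Sum>a\<in>?C. echar p ((m + l - n) * a)))"
    by (subst sum.swap, rule sum.cong[OF refl], subst sum.swap) (simp add: sum_distrib_left)
  also have "\<dots> = 0"
    using assms by (intro sum.neutral ballI) (auto simp: sum_echar simp flip: of_real_mult)
  finally show ?thesis .
qed

text \<open>The set \<open>A\<close> and the bounds \<open>L\<close> and \<open>M\<close> are left
  free because the theorem needs two choices: the \<open>k\<close> largest frequencies, and the
  whole spectrum with \<open>M = 0\<close>.\<close>

lemma card_conv_nonpos_bound:
  assumes "prime p" "f \<in> {0..<int p} \<rightarrow> {0..1}"
    and A: "A \<subseteq> {0..<int p}" "A \<noteq> {}" "4 ^ card A < p"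
    and "L \<ge> 0" "\<And>a. a \<in> A \<Longrightarrow> L \<le> cmod (fourier p f a)"
    and M: "\<And>a. a \<in> {0..<int p} - A \<Longrightarrow> cmod (fourier p f a) \<le> M"
  shows "real (card {n \<in> {0..<int p}. conv p f f n \<le> 0}) * L ^ 4
    \<le> 2 * M\<^sup>2 * (real p)\<^sup>2 * (\<Sum>n\<in>{0..<int p}. f n)"
proof -
  let ?C = "{0..<int p}"
  let ?N = "{n \<in> ?C. conv p f f n \<le> 0}"
  have p: "p > 0" using assms(1) prime_gt_0_nat by blast
  obtain s c where c: "c \<in> A" "(c + s) mod int p \<in> A"
    and uniq: "\<And>a. a \<in> A \<Longrightarrow> (a + s) mod int p \<in> A \<Longrightarrow> a = c"
    by (rule unique_difference[OF assms(1) A]) blast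
  define G where "G a = fourier p f (a + s) * fourier p f a" for a
  define T where "T n = (\<Sum>a\<in>?C - {c}. G a * echar p (a * n))" for n
  have G_c: "L\<^sup>2 \<le> cmod (G c)"
    unfolding G_def norm_mult power2_eq_square
    using assms(6) assms(7)[OF c(1)] assms(7)[OF c(2)] by (intro mult_mono) (auto simp: fourier_mod[OF p])
  \<comment> \<open>Conjugation changes the sign of the exponent, so that \<open>parseval\<close>
    applies without reindexing the sum over \<open>n\<close>.\<close>
  have cmod_T: "cmod (T (- n)) = cmod (\<Sum>a\<in>?C - {c}. cnj (G a) * echar p (a * n))" for n
  proof -
    have "cnj (T (- n)) = (\<Sum>a\<in>?C - {c}. cnj (G a) * echar p (a * n))"
      by (simp add: T_def cnj_echar)
    then show ?thesis by (metis complex_mod_cnj)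
  qed
  have T_ge: "L ^ 4 \<le> (cmod (T (- n)))\<^sup>2" if "n \<in> ?N" for n
  proof -
    have "f m * f l = 0" if "m \<in> ?C" "l \<in> ?C" "int p dvd m + l - n" for m l
      using conv_nonpos_imp_product_zero[of p f n m l] that \<open>n \<in> ?N\<close> assms(2) prime_gt_1_nat[OF assms(1)]
      by fastforce
    then have "(\<Sum>a\<in>?C. G a * echar p (a * (- n))) = 0"
      unfolding G_def by (rule sum_fourier_shift_product[OF p])
    then have "G c * echar p (c * (- n)) + T (- n) = 0"
      using c(1) A(1) by (subst (asm) sum.remove[of _ c]) (auto simp: T_def)
    then have "cmod (T (- n)) = cmod (G c)"
      by (metis add_eq_0_iff norm_minus_cancel norm_mult norm_echar mult.right_neutral)
    then have "(L\<^sup>2)\<^sup>2 \<le> (cmod (T (- n)))\<^sup>2" using G_c by (intro power_mono) auto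
    then show ?thesis by simp
  qed
  \<comment> \<open>For \<open>a\<close> other than \<open>c\<close>, one of the two factors of
    \<open>G a\<close> is at most \<open>M\<close>, but which one depends on \<open>a\<close>.
    Bounding the other by the sum of both squares covers both cases and produces the factor
    2.\<close>
  have G_le: "(cmod (G a))\<^sup>2 \<le> M\<^sup>2 * ((cmod (fourier p f (a + s)))\<^sup>2 + (cmod (fourier p f a))\<^sup>2)"
    if a: "a \<in> ?C - {c}" for a
  proof -
    consider "a \<notin> A" | "(a + s) mod int p \<notin> A" using uniq[of a] a by blast
    then have "cmod (fourier p f a) \<le> M \<or> cmod (fourier p f (a + s)) \<le> M"
    proof cases
      case 1
      then show ?thesis using M[of a] a by auto
    next
      case 2
      then show ?thesis using M[of "(a + s) mod int p"] p by (auto simp: fourier_mod)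
    qed
    then have "(cmod (fourier p f a))\<^sup>2 \<le> M\<^sup>2 \<or> (cmod (fourier p f (a + s)))\<^sup>2 \<le> M\<^sup>2"
      by (auto intro: power_mono)
    then show ?thesis
    proof
      assume "(cmod (fourier p f a))\<^sup>2 \<le> M\<^sup>2"
      then show ?thesis
        using mult_right_mono[of "(cmod (fourier p f a))\<^sup>2" "M\<^sup>2" "(cmod (fourier p f (a + s)))\<^sup>2"]
        by (simp add: G_def norm_mult power_mult_distrib ring_distribs mult_ac add_increasing2)
    next
      assume "(cmod (fourier p f (a + s)))\<^sup>2 \<le> M\<^sup>2"
      then show ?thesis
        using mult_right_mono[of "(cmod (fourier p f (a + s)))\<^sup>2" "M\<^sup>2" "(cmod (fourier p f a))\<^sup>2"]
        by (simp add: G_def norm_mult power_mult_distrib ring_distribs mult_ac add_increasing)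
    qed
  qed
  have "real (card ?N) * L ^ 4 = (\<Sum>n\<in>?N. L ^ 4)" by simp
  also have "\<dots> \<le> (\<Sum>n\<in>?N. (cmod (T (- n)))\<^sup>2)" by (intro sum_mono T_ge)
  also have "\<dots> \<le> (\<Sum>n\<in>?C. (cmod (T (- n)))\<^sup>2)" by (intro sum_mono2) auto
  also have "\<dots> = real p * (\<Sum>a\<in>?C - {c}. (cmod (G a))\<^sup>2)"
    using parseval[OF p, of "?C - {c}" "\<lambda>a. cnj (G a)"] by (simp add: cmod_T)
  also have "\<dots> \<le> real p * (\<Sum>a\<in>?C - {c}.
      M\<^sup>2 * ((cmod (fourier p f (a + s)))\<^sup>2 + (cmod (fourier p f a))\<^sup>2))"
    by (intro mult_left_mono sum_mono G_le) auto
  also have "\<dots> \<le> real p * (\<Sum>a\<in>?C.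
      M\<^sup>2 * ((cmod (fourier p f (a + s)))\<^sup>2 + (cmod (fourier p f a))\<^sup>2))"
    by (intro mult_left_mono sum_mono2) auto
  also have "\<dots> = 2 * M\<^sup>2 * (real p)\<^sup>2 * (\<Sum>n\<in>?C. (f n)\<^sup>2)"
    unfolding sum_distrib_left[symmetric] sum.distrib sum_fourier_square[OF p]
      sum_fourier_shift_square[OF p]
    by (simp add: power2_eq_square)
  \<comment> \<open>As \<open>f\<close> takes values in \<open>[0,1]\<close>, its square is at most
    \<open>f\<close>; the remaining sum is \<theta> times \<open>p\<close> in the theorem.\<close>
  also have "\<dots> \<le> 2 * M\<^sup>2 * (real p)\<^sup>2 * (\<Sum>n\<in>?C. f n)"
  proof (intro mult_left_mono sum_mono)
    fix n assume "n \<in> ?C"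
    then have "f n \<in> {0..1}" using assms(2) by blast
    then show "(f n)\<^sup>2 \<le> f n" by (simp add: power2_eq_square mult_left_le)
  qed auto
  finally show ?thesis .
qed

theorem theorem1:
  fixes p k :: nat
    and f :: "int \<Rightarrow> real"
    and a :: "nat \<Rightarrow> int"
    and lam :: "nat \<Rightarrow> complex"
    and \<theta> \<gamma> :: real
  assumes "prime p"
    and "f \<in> carrier (Fp p) \<rightarrow> {0..1}"
    and "\<exists>n\<in>carrier (Fp p). f n \<noteq> 0"
    and "\<theta> = (\<Sum>n\<in>carrier (Fp p). f n) / real p"
    and "bij_betw a {1..p} (carrier (Fp p))"
    and "\<And>i j. 1 \<le> i \<Longrightarrow> i \<le> j \<Longrightarrow> j \<le> p \<Longrightarrow> cmod (fourier p f (a i)) \<ge> cmod (fourier p f (a j))"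
    and "\<And>i. i \<in> {1..p} \<Longrightarrow> lam i = fourier p f (a i)"
    and "1 \<le> k" and "real k < ln (real p) / ln 4"
    and "\<gamma> \<ge> 0"
    and "cmod (lam (k + 1)) \<le> \<gamma> * cmod (lam k)"
  shows "real (card {n \<in> carrier (Fp p). conv p f f n > 0})
    \<ge> real p * (1 - 2 * \<theta> * (real p)\<^sup>2 * \<gamma>\<^sup>2 * cmod (lam k) powi (-2))"
proof -
  let ?C = "{0..<int p}"
  let ?N = "{n \<in> ?C. conv p f f n \<le> 0}"
  let ?L = "cmod (lam k)"
  note prime = assms(1)
  note f01 = assms(2)[unfolded carrier_Fp]
  note bij = assms(5)[unfolded carrier_Fp]
  have p: "p > 0" using prime prime_gt_0_nat by blast
  have sum_f: "(\<Sum>n\<in>?C. f n) = \<theta> * real p"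
    using assms(4) p by (simp add: carrier_Fp)
  have "real k * ln 4 < ln (real p)" using assms(9) by (simp add: pos_less_divide_eq)
  then have "ln (4 ^ k) < ln (real p)" by (simp add: ln_realpow)
  then have "real (4 ^ k) < real p" using p by simp
  then have pk: "4 ^ k < p" by (simp only: of_nat_less_iff)
  \<comment> \<open>This ensures that \<open>k + 1\<close> is still an index of the
    ordering.\<close>
  have "k < 4 ^ k" by (induction k) simp_all
  then have kp: "k + 1 \<le> p" using pk by linarith
  have lam: "lam k = fourier p f (a k)" "lam (k + 1) = fourier p f (a (k + 1))"
    using assms(7,8) kp by auto
  have N_le: "real (card ?N) \<le> real p * (2 * \<theta> * (real p)\<^sup>2 * \<gamma>\<^sup>2 * ?L powi (-2))"
  proof (cases "lam k = 0")
    case True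
    \<comment> \<open>Here \<open>0 powi (-2) = 0\<close>, so the claim is that \<open>f * f\<close> is positive everywhere. It is the
      argument above with the whole spectrum of \<open>f\<close>, which has fewer than \<open>k\<close> elements, as \<open>A\<close>.\<close>
    define A where "A = {b \<in> ?C. fourier p f b \<noteq> 0}"
    have AC: "A \<subseteq> ?C" by (auto simp: A_def)
    then have fin: "finite A" using finite_subset by blast
    have "A \<subseteq> a ` {1..k}"
    proof
      fix b assume "b \<in> A"
      then obtain i where i: "i \<in> {1..p}" "b = a i"
        using bij unfolding A_def bij_betw_def by blast
      have "i \<le> k"
      proof (rule ccontr)
        assume "\<not> i \<le> k"
        then have "cmod (fourier p f (a i)) \<le> cmod (fourier p f (a k))"
          using i assms(6)[of k i] assms(8) by auto
        then show False using True lam \<open>b \<in> A\<close> i by (simp add: A_def)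
      qed
      then show "b \<in> a ` {1..k}" using i by auto
    qed
    then have "card A \<le> card (a ` {1..k})" by (intro card_mono) auto
    also have "\<dots> \<le> k" using card_image_le[of "{1..k}" a] by simp
    finally have "4 ^ card A \<le> (4::nat) ^ k" by (simp add: power_increasing)
    then have cardA: "4 ^ card A < p" using pk by linarith
    \<comment> \<open>Since \<open>f\<close> is nonnegative and not identically 0, its transform at
      0 is positive, so the spectrum is nonempty.\<close>
    obtain n0 where "n0 \<in> ?C" "f n0 \<noteq> 0" using assms(3) carrier_Fp by blast
    then have "0 < (\<Sum>n\<in>?C. f n)"
      using f01 by (intro sum_pos2[of _ n0]) (auto simp: Pi_iff order_less_le)
    moreover have "fourier p f 0 = of_real (\<Sum>n\<in>?C. f n)"
      using p by (simp add: fourier_echar echar_def)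
    ultimately have A0: "0 \<in> A" using p by (auto simp: A_def simp del: of_real_sum)
    then have A_ne: "A \<noteq> {}" by blast
    \<comment> \<open>The least nonzero modulus serves as \<open>L\<close>. With
      \<open>M = 0\<close> the bound becomes 0, and \<open>L > 0\<close> then excludes every zero of
      the convolution.\<close>
    define L where "L = Min ((\<lambda>b. cmod (fourier p f b)) ` A)"
    have L_le: "L \<le> cmod (fourier p f b)" if "b \<in> A" for b
      using that fin by (simp add: L_def)
    have "L \<in> (\<lambda>b. cmod (fourier p f b)) ` A"
      unfolding L_def using fin A_ne by (intro Min_in) auto
    then have "L > 0" by (auto simp: A_def)
    have "real (card ?N) * L ^ 4 \<le> 2 * 0\<^sup>2 * (real p)\<^sup>2 * (\<Sum>n\<in>?C. f n)"
      by (rule card_conv_nonpos_bound[OF prime f01 AC A_ne cardA _ L_le])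
        (use \<open>L > 0\<close> in \<open>auto simp: A_def\<close>)
    then have "real (card ?N) \<le> 0" using \<open>L > 0\<close> by (simp add: mult_le_0_iff)
    then show ?thesis using True by simp
  next
    case False
    have L: "?L > 0" using False by simp
    define A where "A = a ` {1..k}"
    have inj: "inj_on a {1..k}"
      using bij kp by (auto simp: bij_betw_def intro: inj_on_subset)
    have AC: "A \<subseteq> ?C" using bij kp by (auto simp: bij_betw_def A_def)
    have "card A = k" using inj by (simp add: A_def card_image)
    then have cardA: "4 ^ card A < p" using pk by simp
    have A_ne: "A \<noteq> {}" using assms(8) by (simp add: A_def)
    have large: "?L \<le> cmod (fourier p f b)" if "b \<in> A" for b
      using that assms(6) lam kp by (auto simp: A_def)
    have small: "cmod (fourier p f b) \<le> \<gamma> * ?L" if b: "b \<in> ?C - A" for b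
    proof -
      obtain i where i: "i \<in> {1..p}" "b = a i" using bij b unfolding bij_betw_def by blast
      with b have "k + 1 \<le> i" by (force simp: A_def)
      then have "cmod (fourier p f b) \<le> cmod (lam (k + 1))" using assms(6)[of "k + 1" i] i lam by auto
      then show ?thesis using assms(11) by linarith
    qed
    \<comment> \<open>The bound with \<open>M\<close> equal to \<gamma> times \<open>?L\<close>
      carries \<open>?L\<close> squared on the right and its fourth power on the left. Writing the
      square in this way lets the fourth power cancel.\<close>
    have L_powi: "?L powi (-2) * ?L ^ 4 = ?L\<^sup>2"
      using L by (simp add: power_int_minus divide_simps flip: power_add)
    have "real (card ?N) * ?L ^ 4 \<le> 2 * (\<gamma> * ?L)\<^sup>2 * (real p)\<^sup>2 * (\<Sum>n\<in>?C. f n)"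
      by (rule card_conv_nonpos_bound[OF prime f01 AC A_ne cardA _ large small]) simp_all
    also have "\<dots> = real p * (2 * \<theta> * (real p)\<^sup>2 * \<gamma>\<^sup>2 * ?L powi (-2)) * ?L ^ 4"
      unfolding sum_f power_mult_distrib L_powi[symmetric] by (simp only: mult_ac)
    finally show ?thesis using L by (simp only: mult_le_cancel_right zero_less_power)
  qed
  have fin: "finite {n \<in> ?C. P n}" for P
    by (rule finite_subset[of _ ?C]) auto
  have "card {n \<in> ?C. conv p f f n > 0} + card ?N = p"
  proof -
    have "card {n \<in> ?C. conv p f f n > 0} + card ?N = card ({n \<in> ?C. conv p f f n > 0} \<union> ?N)"
      by (rule card_Un_disjoint[symmetric]) (use fin in auto)
    also have "{n \<in> ?C. conv p f f n > 0} \<union> ?N = ?C" by auto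
    finally show ?thesis by simp
  qed
  then have "real (card {n \<in> ?C. conv p f f n > 0}) = real p - real (card ?N)"
    by linarith
  with N_le show ?thesis by (simp only: carrier_Fp right_diff_distrib)
qed

end
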